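(* Let $u,w\in\mathrm{Lip}(\mathbb{R}^3,\mathbb{R})$ be such that $w(0,0,t)<1$ and $w(\pi,0,t)>-1$ for all $t$. Let $M=\{(q,p)\in\mathbb{R}^2 : 0<q<\pi\}$, let $t_0\in\mathbb{R}$, and let $\mu\in M$ be an equilibrium of the system $$\dot q=p,\qquad \dot p=u(q,p,t)\,\sin q-\cos q+w(q,p,t).$$ Suppose there exist a closed subset $U\subset M$ with $\mu\in U\setminus\partial U$ and a $C^1$-function $V\colon U\to\mathbb{R}$ such that (L1) $V(\mu)=0$ and $V>0$ on $U\setminus\{\mu\}$; (L2) the derivative $\dot V$ of $V$ along the system is negative on $U\setminus\{\mu\}$ for all $t$. Then there exist an initial condition $(q_0,p_0)$ at $t=t_0$ and an open neighborhood $B\subset M$ of $\mu$ such that the solution of the system with $(q(t_0),p(t_0))=(q_0,p_0)$ satisfies $(q(t),p(t))\in M\setminus B$ for all $t\geqslant t_0$ in its maximal interval of existence.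
   Context: $\mathrm{Lip}(\mathbb{R}^3,\mathbb{R})$ denotes the set of functions $f\colon\mathbb{R}^3\to\mathbb{R}$, $f=f(q,p,t)$, that are continuous and locally Lipschitz (i.e. Lipschitz on every compact $K\subset\mathbb{R}^3$) in all variables except $t$. No periodicity in $q$ or $t$ is assumed. The system describes an inverted pendulum of unit mass and length, in a gravity field with unit acceleration, whose pivot point moves horizontally with acceleration $u$ and with an additional control torque $w$ applied at the pivot point. The values $q=0$ and $q=\pi$ are the horizontal positions of the rod, and $q=\pi/2$ is the vertical upward position. An equilibrium $\mu$ is a point of the phase space at which the right-hand side of the system vanishes for all $t$. The derivative of $V$ along the system is $\dot V(q,p,t)=\partial_qV(q,p)\,p+\partial_pV(q,p)\,\bigl(u(q,p,t)\sin q-\cos q+w(q,p,t)\bigr)$. *)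

theory Defs
  imports "HOL-Analysis.Analysis"
begin

(* The Lipschitz constant may depend on the compact set K, but not on t. *)
definition Lip :: "(real \<times> real \<times> real \<Rightarrow> real) set" where
  "Lip = {f. continuous_on UNIV f \<and>
     (\<forall>K. compact K \<longrightarrow>
        (\<exists>L. \<forall>t. L-lipschitz_on {(q, p). (q, p, t) \<in> K} (\<lambda>(q, p). f (q, p, t))))}"

definition M :: "(real \<times> real) set" where
  "M = {(q, p). 0 < q \<and> q < pi}"

definition pendulum_field ::
  "(real \<times> real \<times> real \<Rightarrow> real) \<Rightarrow> (real \<times> real \<times> real \<Rightarrow> real) \<Rightarrow> real \<times> real \<Rightarrow> real \<Rightarrow> real \<times> real" where
  "pendulum_field u w = (\<lambda>(q, p) t. (p, u (q, p, t) * sin q - cos q + w (q, p, t)))"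

definition equilibrium ::
  "(real \<times> real \<Rightarrow> real \<Rightarrow> real \<times> real) \<Rightarrow> real \<times> real \<Rightarrow> bool" where
  "equilibrium F \<mu> \<longleftrightarrow> (\<forall>t. F \<mu> t = 0)"

definition solves_on ::
  "(real \<times> real \<Rightarrow> real \<Rightarrow> real \<times> real) \<Rightarrow> (real \<Rightarrow> real \<times> real) \<Rightarrow> real set \<Rightarrow> bool" where
  "solves_on F x J \<longleftrightarrow> open J \<and> is_interval J \<and>
     (\<forall>t\<in>J. (x has_vector_derivative F (x t) t) (at t))"

(* x is a total function, but only its values on J matter; J is its maximal interval of existence. *)
definition maximal_solution ::
  "(real \<times> real \<Rightarrow> real \<Rightarrow> real \<times> real) \<Rightarrow> real \<Rightarrow> real \<times> real \<Rightarrow> (real \<Rightarrow> real \<times> real) \<Rightarrow> real set \<Rightarrow> bool" where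
  "maximal_solution F t0 z0 x J \<longleftrightarrow>
     t0 \<in> J \<and> x t0 = z0 \<and> solves_on F x J \<and>
     (\<forall>y J'. solves_on F y J' \<and> J \<subseteq> J' \<and> (\<forall>t\<in>J. y t = x t) \<longrightarrow> J' = J)"

(* V is continuously differentiable on U, with partial derivatives Vq and Vp. Differentiability is
   relative to U, so U need not be open; in the interior of U, Vq and Vp are uniquely determined. *)
definition C1_on ::
  "(real \<times> real) set \<Rightarrow> (real \<times> real \<Rightarrow> real) \<Rightarrow> (real \<times> real \<Rightarrow> real) \<Rightarrow> (real \<times> real \<Rightarrow> real) \<Rightarrow> bool" where
  "C1_on U V Vq Vp \<longleftrightarrow>
     (\<forall>z\<in>U. (V has_derivative (\<lambda>(hq, hp). Vq z * hq + Vp z * hp)) (at z within U)) \<and>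
     continuous_on U Vq \<and> continuous_on U Vp"

definition derivative_along ::
  "(real \<times> real \<Rightarrow> real) \<Rightarrow> (real \<times> real \<Rightarrow> real) \<Rightarrow> (real \<times> real \<Rightarrow> real \<Rightarrow> real \<times> real)
    \<Rightarrow> real \<times> real \<Rightarrow> real \<Rightarrow> real" where
  "derivative_along Vq Vp F z t = Vq z * fst (F z t) + Vp z * snd (F z t)"

end

theory Submission imports Defs begin

text \<open>Consider solutions starting on the segment \<open>p = q - pi / 2\<close>, \<open>0 \<le> q \<le> pi\<close>. Where such a solution
  first meets the line \<open>q = 0\<close>, the line \<open>q = pi\<close> or a small sublevel set of \<open>V\<close> around \<open>\<mu>\<close>, it crosses
  at once: on the lines because \<open>w (0, 0, t) < 1\<close> and \<open>w (pi, 0, t) > -1\<close> make the points with \<open>p = 0\<close>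
  points of outer tangency, on the level set because \<open>V\<close> decreases. Hence the initial values that leave
  through each of the three exits form disjoint open sets. The end points of the segment leave
  through different lines, so by connectedness the three sets do not cover the segment, and any point
  left over is the required initial condition.\<close>

section \<open>Solutions for bounded, globally Lipschitz fields\<close>

lemma continuous_has_antiderivative:
  fixes f :: "real \<Rightarrow> 'a::euclidean_space"
  assumes "continuous_on UNIV f"
  obtains H where "H c = z" "\<And>t. (H has_vector_derivative f t) (at t)"
proof -
  obtain F where F: "\<And>t. (F has_vector_derivative f t) (at t)"
    using einterval_antiderivative[of "-\<infinity>" "\<infinity>" f] assms
    by (auto simp: continuous_on_eq_continuous_at)
  have "((\<lambda>t. F t - F c + z) has_vector_derivative f t) (at t)" for t
    by (auto intro!: derivative_eq_intros F)
  then show ?thesis using that[of "\<lambda>t. F t - F c + z"] by simp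
qed

text \<open>The mean value inequality with comparison function
  \<open>A / k * exp (k * (t - c))\<close>, whose derivative is the assumed bound. The gained factor
  \<open>1 / k\<close> is what makes the Picard operator contract for large
  \<open>k\<close>.\<close>

lemma norm_le_exp_of_derivative_forward:
  fixes H :: "real \<Rightarrow> 'a::real_normed_vector"
  assumes H: "\<And>t. (H has_vector_derivative h t) (at t)"
    and b: "\<And>t. norm (h t) \<le> A * exp (k * \<bar>t - c\<bar>)" and k: "k > 0" and "c \<le> t"
  shows "norm (H t - H c) \<le> A / k * exp (k * \<bar>t - c\<bar>)"
proof -
  have A: "A \<ge> 0" using b[of c] order_trans[OF norm_ge_zero] by fastforce
  show ?thesis
  proof (cases "c = t")
    case True then show ?thesis using A k by simp
  next
    case False
    have cH: "continuous_on {c..t} H"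
      using H by (meson continuous_at_imp_continuous_on has_vector_derivative_continuous)
    have "norm (H t - H c) \<le> A / k * exp (k * (t - c)) - A / k * exp (k * (c - c))"
    proof (rule differentiable_bound_general[OF _ cH])
      show "((\<lambda>t. A / k * exp (k * (t - c))) has_vector_derivative A * exp (k * (x - c))) (at x)" for x
        unfolding has_real_derivative_iff_has_vector_derivative[symmetric]
        using k by (auto intro!: derivative_eq_intros)
      show "norm (h x) \<le> A * exp (k * (x - c))" if "c < x" for x using b[of x] that by simp
    qed (use \<open>c \<le> t\<close> False k in \<open>auto intro!: continuous_intros H\<close>)
    also have "\<dots> \<le> A / k * exp (k * \<bar>t - c\<bar>)" using A k \<open>c \<le> t\<close> by simp
    finally show ?thesis .
  qed
qed

text \<open>The bound depends only on the distance to \<open>c\<close>, so the reflection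
  \<open>s \<mapsto> 2 * c - s\<close> turns times before \<open>c\<close> into times after
  it.\<close>

lemma norm_le_exp_of_derivative:
  fixes H :: "real \<Rightarrow> 'a::real_normed_vector"
  assumes H: "\<And>t. (H has_vector_derivative h t) (at t)"
    and b: "\<And>t. norm (h t) \<le> A * exp (k * \<bar>t - c\<bar>)" and k: "k > 0"
  shows "norm (H t - H c) \<le> A / k * exp (k * \<bar>t - c\<bar>)"
proof (cases "c \<le> t")
  case True then show ?thesis using norm_le_exp_of_derivative_forward[OF H b k] by blast
next
  case False
  have "norm (H (2 * c - (2 * c - t)) - H (2 * c - c)) \<le> A / k * exp (k * \<bar>(2 * c - t) - c\<bar>)"
  proof (rule norm_le_exp_of_derivative_forward[where H = "\<lambda>s. H (2 * c - s)" and h = "\<lambda>s. - h (2 * c - s)"])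
    show "((\<lambda>s. H (2 * c - s)) has_vector_derivative - h (2 * c - t)) (at t)" for t
    proof -
      have "((\<lambda>s. 2 * c - s) has_vector_derivative -1) (at t)"
        by (auto intro!: derivative_eq_intros)
      from vector_diff_chain_at[OF this H] show ?thesis by (simp add: o_def)
    qed
    show "norm (- h (2 * c - t)) \<le> A * exp (k * \<bar>t - c\<bar>)" for t
      using b[of "2 * c - t"] by (simp add: abs_minus_commute)
  qed (use False k in auto)
  then show ?thesis by (simp add: abs_minus_commute)
qed

text \<open>Banach's fixed point theorem is applied in the norm weighted by
  \<open>exp (- k * \<bar>t - t0\<bar>)\<close>, in which the Picard operator is a contraction on the whole line.\<close>

lemma global_solution_exists:
  fixes G :: "'a::euclidean_space \<Rightarrow> real \<Rightarrow> 'a"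
  assumes cont: "continuous_on UNIV (\<lambda>(z, t). G z t)"
    and bd: "\<And>z t. norm (G z t) \<le> A"
    and lip: "\<And>z z' t. norm (G z t - G z' t) \<le> L * norm (z - z')"
  obtains x where "x t0 = z0" "\<And>t. (x has_vector_derivative G (x t) t) (at t)"
proof -
  \<comment> \<open>This choice gives \<open>\<bar>L\<bar> / k \<le> 1/2\<close>, the contraction
    ratio; the summand 1 keeps \<open>k\<close> positive when \<open>L = 0\<close>.\<close>
  define k where "k = 2 * \<bar>L\<bar> + 1"
  have k: "k > 0" by (simp add: k_def)
  have A: "A \<ge> 0" using bd order_trans norm_ge_zero by blast
  define W where "W t = exp (k * \<bar>t - t0\<bar>)" for t
  have W: "W t \<ge> 1" for t using k by (simp add: W_def)
  have W0: "W t > 0" for t by (simp add: W_def)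
  have cW: "continuous_on UNIV W" unfolding W_def by (intro continuous_intros)
  \<comment> \<open>A bounded continuous \<open>\<phi>\<close> stands for the curve
    \<open>W t *\<^sub>R \<phi> t\<close>, so the sup norm of \<open>\<phi>\<close> is the weighted
    norm of the curve. An antiderivative with value \<open>z0\<close> at \<open>t0\<close> takes the
    place of the Picard integral.\<close>
  have "\<exists>H. H t0 = z0 \<and> (\<forall>t. (H has_vector_derivative G (W t *\<^sub>R \<phi> t) t) (at t))"
    for \<phi> :: "real \<Rightarrow>\<^sub>C 'a"
  proof -
    have "continuous_on UNIV (\<lambda>t. (\<lambda>(z, t). G z t) (W t *\<^sub>R \<phi> t, t))"
      by (rule continuous_on_compose2[OF cont]) (auto intro!: continuous_intros cW)
    then show ?thesis using continuous_has_antiderivative[of "\<lambda>t. G (W t *\<^sub>R \<phi> t) t" t0 z0] by auto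
  qed
  then obtain H :: "(real \<Rightarrow>\<^sub>C 'a) \<Rightarrow> real \<Rightarrow> 'a" where H0: "\<And>\<phi>. H \<phi> t0 = z0"
    and H: "\<And>\<phi> t. (H \<phi> has_vector_derivative G (W t *\<^sub>R \<phi> t) t) (at t)" by metis
  define T where "T \<phi> = Bcontfun (\<lambda>t. inverse (W t) *\<^sub>R H \<phi> t)" for \<phi>
  have bc: "(\<lambda>t. inverse (W t) *\<^sub>R H \<phi> t) \<in> bcontfun" for \<phi>
  proof -
    have cH: "continuous_on UNIV (H \<phi>)"
      using H by (meson continuous_at_imp_continuous_on has_vector_derivative_continuous)
    have "norm (inverse (W t) *\<^sub>R H \<phi> t) \<le> norm z0 + A / k" for t
    proof -
      have "norm (H \<phi> t - H \<phi> t0) \<le> A / k * exp (k * \<bar>t - t0\<bar>)"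
      proof (rule norm_le_exp_of_derivative[OF H _ k])
        fix t show "norm (G (W t *\<^sub>R \<phi> t) t) \<le> A * exp (k * \<bar>t - t0\<bar>)"
          using bd[of "W t *\<^sub>R \<phi> t" t] mult_left_mono[OF W[of t] A] by (simp add: W_def)
      qed
      then have "norm (H \<phi> t) \<le> norm z0 + A / k * W t"
        unfolding H0 W_def using norm_triangle_ineq2[of "H \<phi> t" z0] by linarith
      also have "\<dots> \<le> norm z0 * W t + A / k * W t"
        using mult_left_mono[OF W[of t], of "norm z0"] by simp
      finally show ?thesis using W0[of t] by (simp add: field_simps)
    qed
    then have "bounded (range (\<lambda>t. inverse (W t) *\<^sub>R H \<phi> t))" by (auto simp: bounded_iff)
    moreover have "continuous_on UNIV (\<lambda>t. inverse (W t) *\<^sub>R H \<phi> t)"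
      using W0 by (intro continuous_intros cW cH) (auto simp: less_imp_neq[symmetric] dest: less_imp_neq)
    ultimately show ?thesis by (simp add: bcontfun_def)
  qed
  then have T: "T \<phi> t = inverse (W t) *\<^sub>R H \<phi> t" for \<phi> t
    by (simp add: T_def Bcontfun_inverse)
  have "dist (T \<phi>) (T \<psi>) \<le> 1/2 * dist \<phi> \<psi>" for \<phi> \<psi>
  proof (rule dist_bound)
    fix t
    have "norm ((H \<phi> t - H \<psi> t) - (H \<phi> t0 - H \<psi> t0)) \<le> \<bar>L\<bar> * dist \<phi> \<psi> / k * exp (k * \<bar>t - t0\<bar>)"
    proof (rule norm_le_exp_of_derivative[OF _ _ k])
      show "((\<lambda>t. H \<phi> t - H \<psi> t) has_vector_derivative (G (W t *\<^sub>R \<phi> t) t - G (W t *\<^sub>R \<psi> t) t)) (at t)" for t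
        by (intro derivative_intros H)
      fix t
      have "norm (G (W t *\<^sub>R \<phi> t) t - G (W t *\<^sub>R \<psi> t) t) \<le> L * norm (W t *\<^sub>R \<phi> t - W t *\<^sub>R \<psi> t)"
        by (rule lip)
      also have "\<dots> \<le> \<bar>L\<bar> * norm (W t *\<^sub>R \<phi> t - W t *\<^sub>R \<psi> t)" by (intro mult_right_mono) auto
      also have "norm (W t *\<^sub>R \<phi> t - W t *\<^sub>R \<psi> t) = W t * dist (\<phi> t) (\<psi> t)"
        using W0[of t] by (simp add: dist_norm flip: scaleR_diff_right)
      also have "\<bar>L\<bar> * (W t * dist (\<phi> t) (\<psi> t)) \<le> \<bar>L\<bar> * (W t * dist \<phi> \<psi>)"
        using W0[of t] by (intro mult_left_mono dist_bounded) auto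
      finally show "norm (G (W t *\<^sub>R \<phi> t) t - G (W t *\<^sub>R \<psi> t) t) \<le> \<bar>L\<bar> * dist \<phi> \<psi> * exp (k * \<bar>t - t0\<bar>)"
        by (simp add: W_def mult_ac)
    qed
    then have "norm (H \<phi> t - H \<psi> t) \<le> \<bar>L\<bar> / k * dist \<phi> \<psi> * W t" by (simp add: H0 W_def)
    also have "\<dots> \<le> 1/2 * dist \<phi> \<psi> * W t"
      using W0[of t] k by (intro mult_right_mono) (auto simp: k_def field_simps)
    finally have "norm (H \<phi> t - H \<psi> t) \<le> 1/2 * dist \<phi> \<psi> * W t" .
    moreover have "dist (T \<phi> t) (T \<psi> t) = norm (H \<phi> t - H \<psi> t) / W t"
      using W0[of t] by (simp add: T dist_norm divide_inverse mult.commute flip: scaleR_diff_right)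
    ultimately show "dist (T \<phi> t) (T \<psi> t) \<le> 1/2 * dist \<phi> \<psi>"
      using W0[of t] by (simp add: pos_divide_le_eq)
  qed
  then obtain \<phi> where "T \<phi> = \<phi>" using banach_fix_type[of "1/2" T] by auto
  \<comment> \<open>With the weight removed, the curve equals its own Picard image
    \<open>H \<phi>\<close>, which is therefore a solution.\<close>
  then have "W t *\<^sub>R \<phi> t = H \<phi> t" for t using W0[of t] T[of \<phi> t] by simp
  then show ?thesis using that[of "H \<phi>"] H0[of \<phi>] H[of \<phi>] by simp
qed

text \<open>The squared distance is differentiable even where the two curves meet. By Cauchy-Schwarz
  its derivative is at most \<open>2 * L\<close> times itself in absolute value, so the factor
  \<open>exp (- 2 * L * (t - a))\<close> makes it nonincreasing and
  \<open>exp (2 * L * (t - a))\<close> nondecreasing. The second estimate runs backwards in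
  time.\<close>

lemma gronwall:
  fixes x y :: "real \<Rightarrow> 'a::real_inner"
  assumes "a \<le> b" "L \<ge> 0"
    and x: "\<And>t. t \<in> {a..b} \<Longrightarrow> (x has_vector_derivative f t) (at t)"
    and y: "\<And>t. t \<in> {a..b} \<Longrightarrow> (y has_vector_derivative g t) (at t)"
    and lip: "\<And>t. t \<in> {a..b} \<Longrightarrow> norm (f t - g t) \<le> L * norm (x t - y t)"
  shows "norm (x b - y b) \<le> norm (x a - y a) * exp (L * (b - a))"
    and "norm (x a - y a) \<le> norm (x b - y b) * exp (L * (b - a))"
proof -
  define d where "d t = x t - y t" for t
  have inner_der: "((\<lambda>t. d t \<bullet> d t) has_real_derivative 2 * (d t \<bullet> (f t - g t))) (at t)"
    if "t \<in> {a..b}" for t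
  proof -
    have "(d has_derivative (\<lambda>h. h *\<^sub>R (f t - g t))) (at t)"
      using has_vector_derivative_diff[OF x[OF that] y[OF that]]
      by (simp add: d_def[abs_def] has_vector_derivative_def)
    from has_derivative_inner[OF this this] show ?thesis
      unfolding has_field_derivative_def
      by (rule has_derivative_eq_rhs) (simp add: inner_commute fun_eq_iff)
  qed
  have bound: "\<bar>d t \<bullet> (f t - g t)\<bar> \<le> L * (d t \<bullet> d t)" if "t \<in> {a..b}" for t
  proof -
    have "\<bar>d t \<bullet> (f t - g t)\<bar> \<le> norm (d t) * norm (f t - g t)" by (rule Cauchy_Schwarz_ineq2)
    also have "\<dots> \<le> norm (d t) * (L * norm (d t))"
      using lip[OF that] by (intro mult_left_mono) (auto simp: d_def)
    finally show ?thesis by (simp add: dot_square_norm power2_eq_square mult_ac)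
  qed
  have exp2: "(exp (L * (b - a)))\<^sup>2 = exp (2 * L * (b - a))"
    by (simp only: mult.assoc exp_double)
  have "(d b \<bullet> d b) * exp (- 2 * L * (b - a)) \<le> (d a \<bullet> d a) * exp (- 2 * L * (a - a))"
  proof (rule DERIV_nonpos_imp_nonincreasing[OF \<open>a \<le> b\<close>], intro exI conjI)
    fix t assume t: "a \<le> t" "t \<le> b"
    show "((\<lambda>t. (d t \<bullet> d t) * exp (- 2 * L * (t - a))) has_real_derivative
      2 * exp (- 2 * L * (t - a)) * (d t \<bullet> (f t - g t) - L * (d t \<bullet> d t))) (at t)"
      by (rule derivative_eq_intros inner_der refl | use t in \<open>simp add: algebra_simps\<close>)+
    show "2 * exp (- 2 * L * (t - a)) * (d t \<bullet> (f t - g t) - L * (d t \<bullet> d t)) \<le> 0"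
      using bound[of t] t by (intro mult_nonneg_nonpos) auto
  qed
  then have "d b \<bullet> d b \<le> (d a \<bullet> d a) * exp (2 * L * (b - a))"
    by (simp only: mult_minus_left diff_self mult_zero_right exp_zero mult_1_right exp_minus
        divide_inverse[symmetric] pos_divide_le_eq[OF exp_gt_zero])
  then have "(norm (d b))\<^sup>2 \<le> (norm (d a) * exp (L * (b - a)))\<^sup>2"
    by (simp only: dot_square_norm power_mult_distrib exp2)
  then show "norm (x b - y b) \<le> norm (x a - y a) * exp (L * (b - a))"
    unfolding d_def by (rule power2_le_imp_le) auto
  have "(d a \<bullet> d a) * exp (2 * L * (a - a)) \<le> (d b \<bullet> d b) * exp (2 * L * (b - a))"
  proof (rule DERIV_nonneg_imp_nondecreasing[OF \<open>a \<le> b\<close>], intro exI conjI)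
    fix t assume t: "a \<le> t" "t \<le> b"
    show "((\<lambda>t. (d t \<bullet> d t) * exp (2 * L * (t - a))) has_real_derivative
      2 * exp (2 * L * (t - a)) * (d t \<bullet> (f t - g t) + L * (d t \<bullet> d t))) (at t)"
      by (rule derivative_eq_intros inner_der refl | use t in \<open>simp add: algebra_simps\<close>)+
    show "2 * exp (2 * L * (t - a)) * (d t \<bullet> (f t - g t) + L * (d t \<bullet> d t)) \<ge> 0"
      using bound[of t] t by (intro mult_nonneg_nonneg) auto
  qed
  then have "(norm (d a))\<^sup>2 \<le> (norm (d b) * exp (L * (b - a)))\<^sup>2"
    by (simp only: dot_square_norm power_mult_distrib exp2 diff_self mult_zero_right exp_zero mult_1_right)
  then show "norm (x a - y a) \<le> norm (x b - y b) * exp (L * (b - a))"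
    unfolding d_def by (rule power2_le_imp_le) auto
qed

section \<open>Locally Lipschitz fields in the plane\<close>

locale locally_lipschitz_field =
  fixes F :: "real \<times> real \<Rightarrow> real \<Rightarrow> real \<times> real"
  assumes continuous_field: "continuous_on UNIV (\<lambda>(z, t). F z t)"
    and lipschitz_field: "\<And>R. \<exists>L\<ge>0. \<forall>t\<in>{-R..R}. \<forall>z\<in>cball 0 R. \<forall>z'\<in>cball 0 R.
      norm (F z t - F z' t) \<le> L * norm (z - z')"
begin

text \<open>Composing \<open>F\<close> with the projection onto the ball and with the clamping of
  time to \<open>{-R..R}\<close> makes it bounded and globally Lipschitz, because the projection is
  nonexpansive. Solutions then exist for all times and solve the original equation while state and
  time stay within \<open>R\<close>.\<close>

lemma truncation:
  assumes "R > 0"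
  shows "\<exists>L G. L \<ge> 0 \<and> (\<forall>z z' t. norm (G z t - G z' t) \<le> L * norm (z - z')) \<and>
    (\<forall>z t. norm z \<le> R \<longrightarrow> \<bar>t\<bar> \<le> R \<longrightarrow> G z t = F z t) \<and>
    (\<forall>t0 z. \<exists>y. y t0 = z \<and> (\<forall>t. (y has_vector_derivative G (y t) t) (at t)))"
proof -
  obtain L where L: "L \<ge> 0" "\<And>t z z'. t \<in> {-R..R} \<Longrightarrow> z \<in> cball 0 R \<Longrightarrow> z' \<in> cball 0 R \<Longrightarrow>
      norm (F z t - F z' t) \<le> L * norm (z - z')"
    using lipschitz_field[of R] by metis
  define P where "P = closest_point (cball (0 :: real \<times> real) R)"
  define Q where "Q t = max (- R) (min R t)" for t
  define G where "G z t = F (P z) (Q t)" for z t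
  have P: "P z \<in> cball 0 R" for z
    unfolding P_def using assms by (intro closest_point_in_set) auto
  have Q: "Q t \<in> {-R..R}" for t using assms by (auto simp: Q_def)
  have lipP: "norm (P z - P z') \<le> norm (z - z')" for z z'
    unfolding P_def using assms closest_point_lipschitz[of "cball 0 R" z z'] by (simp add: dist_norm)
  have cP: "continuous_on UNIV P"
    unfolding P_def using assms by (intro continuous_on_closest_point) auto
  have cont: "continuous_on UNIV (\<lambda>(z, t). G z t)"
  proof -
    have "continuous_on UNIV (\<lambda>s. (\<lambda>(z, t). F z t) (P (fst s), Q (snd s)))"
      unfolding Q_def
      by (rule continuous_on_compose2[OF continuous_field])
        (auto intro!: continuous_intros continuous_on_compose2[OF cP])
    then show ?thesis by (simp add: G_def case_prod_beta')
  qed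
  have "compact ((\<lambda>(z, t). F z t) ` (cball 0 R \<times> {-R..R}))"
    by (intro compact_continuous_image compact_Times continuous_on_subset[OF continuous_field]) auto
  then obtain A where A: "\<And>v. v \<in> (\<lambda>(z, t). F z t) ` (cball 0 R \<times> {-R..R}) \<Longrightarrow> norm v \<le> A"
    using compact_imp_bounded bounded_iff by metis
  have bd: "norm (G z t) \<le> A" for z t
    unfolding G_def using P[of z] Q[of t] by (intro A) force
  have lip: "norm (G z t - G z' t) \<le> L * norm (z - z')" for z z' t
    unfolding G_def
    using L(2)[OF Q[of t] P[of z] P[of z']] mult_left_mono[OF lipP[of z z'] L(1)] by linarith
  have agree: "G z t = F z t" if "norm z \<le> R" "\<bar>t\<bar> \<le> R" for z t
  proof -
    have "P z = z" unfolding P_def using that by (intro closest_point_self) auto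
    moreover have "Q t = t" using that by (auto simp: Q_def)
    ultimately show ?thesis by (simp add: G_def)
  qed
  have "\<exists>y. y t0 = z \<and> (\<forall>t. (y has_vector_derivative G (y t) t) (at t))" for t0 z
    using global_solution_exists[OF cont bd lip, of t0 z] by metis
  then show ?thesis using L(1) lip agree by (intro exI[of _ L] exI[of _ G]) simp
qed

text \<open>\<open>solves_on\<close> demands an open domain. The strict bounds define an open set of
  times, so by compactness they persist slightly beyond both ends of \<open>{a..b}\<close>.\<close>

lemma solves_on_of_truncation:
  assumes agree: "\<And>z t. norm z \<le> R \<Longrightarrow> \<bar>t\<bar> \<le> R \<Longrightarrow> G z t = F z t"
    and y: "\<And>t. (y has_vector_derivative G (y t) t) (at t)"
    and small: "\<And>t. t \<in> {a..b} \<Longrightarrow> norm (y t) < R \<and> \<bar>t\<bar> < R"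
    and "a \<le> b"
  obtains J where "solves_on F y J" "{a..b} \<subseteq> J"
proof -
  have cy: "continuous_on UNIV y"
    using y by (meson continuous_at_imp_continuous_on has_vector_derivative_continuous)
  have "open {t. norm (y t) < R \<and> \<bar>t\<bar> < R}"
    by (intro open_Collect_conj open_Collect_less continuous_intros cy)
  then obtain e where e: "e > 0" "(\<Union>t\<in>{a..b}. ball t e) \<subseteq> {t. norm (y t) < R \<and> \<bar>t\<bar> < R}"
    using compact_subset_open_imp_ball_epsilon_subset[of "{a..b}"] small by blast
  have "{a - e<..<b + e} \<subseteq> (\<Union>t\<in>{a..b}. ball t e)"
  proof
    fix t assume "t \<in> {a - e<..<b + e}"
    \<comment> \<open>The point of \<open>{a..b}\<close> nearest to \<open>t\<close>.\<close>
    then have "max a (min b t) \<in> {a..b}" "t \<in> ball (max a (min b t)) e"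
      using \<open>a \<le> b\<close> e(1) by (auto simp: dist_real_def max_def min_def)
    then show "t \<in> (\<Union>t\<in>{a..b}. ball t e)" by blast
  qed
  then have sub: "{a - e<..<b + e} \<subseteq> {t. norm (y t) < R \<and> \<bar>t\<bar> < R}" using e(2) by blast
  have "(y has_vector_derivative F (y t) t) (at t)" if "t \<in> {a - e<..<b + e}" for t
  proof -
    have "norm (y t) \<le> R" "\<bar>t\<bar> \<le> R" using sub that by auto
    then show ?thesis using y[of t] agree by simp
  qed
  then have "solves_on F y {a - e<..<b + e}"
    unfolding solves_on_def by (auto simp: is_interval_oo)
  then show ?thesis by (rule that) (use e(1) \<open>a \<le> b\<close> in auto)
qed

section \<open>Uniqueness and continuous dependence on the initial value\<close>

lemma solution_continuous:
  assumes "solves_on F x J" "S \<subseteq> J" shows "continuous_on S x"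
  using assms unfolding solves_on_def
  by (meson continuous_at_imp_continuous_on has_vector_derivative_continuous subsetD)

lemma solution_bounded:
  assumes "solves_on F x J" "{a..b} \<subseteq> J"
  obtains R where "R > 0" "\<And>t. t \<in> {a..b} \<Longrightarrow> norm (x t) < R \<and> \<bar>t\<bar> < R"
proof -
  have "compact (x ` {a..b})" using solution_continuous[OF assms] by (intro compact_continuous_image) auto
  then obtain R where R: "\<And>t. t \<in> {a..b} \<Longrightarrow> norm (x t) \<le> R"
    using compact_imp_bounded bounded_iff by (metis imageI)
  show ?thesis
  proof (rule that[of "\<bar>R\<bar> + \<bar>a\<bar> + \<bar>b\<bar> + 1"])
    fix t assume t: "t \<in> {a..b}"
    have "norm (x t) \<le> \<bar>R\<bar>" "\<bar>t\<bar> \<le> \<bar>a\<bar> + \<bar>b\<bar>" using R[OF t] t by auto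
    then show "norm (x t) < \<bar>R\<bar> + \<bar>a\<bar> + \<bar>b\<bar> + 1 \<and> \<bar>t\<bar> < \<bar>R\<bar> + \<bar>a\<bar> + \<bar>b\<bar> + 1" by auto
  qed auto
qed

text \<open>Between \<open>t0\<close> and \<open>t\<close> both solutions stay in a common ball, so
  one Lipschitz constant serves there. Gronwall's estimate is used forwards if
  \<open>t0 \<le> t\<close> and backwards otherwise.\<close>

lemma solution_unique:
  assumes x: "solves_on F x J" and y: "solves_on F y J'"
    and "t0 \<in> J \<inter> J'" "t \<in> J \<inter> J'" "x t0 = y t0"
  shows "x t = y t"
proof -
  define a b where "a = min t0 t" and "b = max t0 t"
  have "a \<in> J \<inter> J'" "b \<in> J \<inter> J'" using assms(3,4) by (auto simp: a_def b_def min_def max_def)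
  then have sub: "{a..b} \<subseteq> J" "{a..b} \<subseteq> J'"
    using x y unfolding solves_on_def is_interval_1 by (meson IntD1 IntD2 atLeastAtMost_iff subsetI)+
  obtain R1 R2 where R1: "\<And>t. t \<in> {a..b} \<Longrightarrow> norm (x t) < R1 \<and> \<bar>t\<bar> < R1"
    and R2: "\<And>t. t \<in> {a..b} \<Longrightarrow> norm (y t) < R2 \<and> \<bar>t\<bar> < R2"
    using solution_bounded[OF x sub(1)] solution_bounded[OF y sub(2)] by metis
  obtain L where L: "L \<ge> 0" "\<And>t z z'. t \<in> {- max R1 R2..max R1 R2} \<Longrightarrow> z \<in> cball 0 (max R1 R2) \<Longrightarrow>
      z' \<in> cball 0 (max R1 R2) \<Longrightarrow> norm (F z t - F z' t) \<le> L * norm (z - z')"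
    using lipschitz_field[of "max R1 R2"] by metis
  have lip: "norm (F (x s) s - F (y s) s) \<le> L * norm (x s - y s)" if "s \<in> {a..b}" for s
    using R1[OF that] R2[OF that] by (intro L) auto
  have "a \<le> b" by (simp add: a_def b_def)
  have "norm (x b - y b) \<le> norm (x a - y a) * exp (L * (b - a))"
    "norm (x a - y a) \<le> norm (x b - y b) * exp (L * (b - a))"
    by (rule gronwall[OF \<open>a \<le> b\<close> L(1) _ _ lip]; use x y sub in \<open>force simp: solves_on_def\<close>)+
  then show ?thesis using \<open>x t0 = y t0\<close>
    by (cases "t0 \<le> t") (auto simp: a_def b_def)
qed

text \<open>The neighbouring solution is taken for a truncated field, where it exists for all times.
  Gronwall's estimate keeps it within \<open>e\<close> of \<open>x\<close>, hence where the two
  fields agree, so it solves the original equation up to \<open>T\<close>.\<close>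

lemma continuous_dependence:
  assumes x: "solves_on F x J" and "{t0..T} \<subseteq> J" "t0 \<le> T" "e > 0"
  obtains d where "d > 0" "\<And>z. dist (x t0) z < d \<Longrightarrow>
    \<exists>y J'. solves_on F y J' \<and> {t0..T} \<subseteq> J' \<and> y t0 = z \<and> (\<forall>t\<in>{t0..T}. dist (x t) (y t) < e)"
proof -
  obtain R0 where R0: "R0 > 0" "\<And>t. t \<in> {t0..T} \<Longrightarrow> norm (x t) < R0 \<and> \<bar>t\<bar> < R0"
    using solution_bounded[OF x assms(2)] by blast
  \<comment> \<open>The margin \<open>e\<close> leaves room for every curve within \<open>e\<close>
    of \<open>x\<close>.\<close>
  define R where "R = R0 + e"
  have "R > 0" using R0 \<open>e > 0\<close> by (simp add: R_def)
  obtain L G where L: "L \<ge> 0" and lip: "\<And>z z' t. norm (G z t - G z' t) \<le> L * norm (z - z')"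
    and agree: "\<And>z t. norm z \<le> R \<Longrightarrow> \<bar>t\<bar> \<le> R \<Longrightarrow> G z t = F z t"
    and ex: "\<And>t0 z. \<exists>y. y t0 = z \<and> (\<forall>t. (y has_vector_derivative G (y t) t) (at t))"
    using truncation[OF \<open>R > 0\<close>] by blast
  \<comment> \<open>\<open>e\<close> divided by the largest growth factor in Gronwall's estimate on
    \<open>{t0..T}\<close>.\<close>
  define d where "d = e * exp (- L * (T - t0))"
  show ?thesis
  proof (rule that[of d])
    show "d > 0" using \<open>e > 0\<close> by (simp add: d_def)
    fix z assume z: "dist (x t0) z < d"
    obtain y where y: "y t0 = z" "\<And>t. (y has_vector_derivative G (y t) t) (at t)" using ex by blast
    have close: "dist (x t) (y t) < e" if t: "t \<in> {t0..T}" for t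
    proof -
      have "norm (x t - y t) \<le> norm (x t0 - y t0) * exp (L * (t - t0))"
      proof (rule gronwall[where f = "\<lambda>s. G (x s) s" and g = "\<lambda>s. G (y s) s"])
        fix s assume "s \<in> {t0..t}"
        then have s: "s \<in> {t0..T}" using t by auto
        then have "G (x s) s = F (x s) s" using R0(2)[OF s] \<open>e > 0\<close> by (intro agree) (auto simp: R_def)
        then show "(x has_vector_derivative G (x s) s) (at s)"
          using x s assms(2) unfolding solves_on_def by auto
      qed (use t L lip y in auto)
      also have "\<dots> \<le> norm (x t0 - y t0) * exp (L * (T - t0))"
        using t L by (intro mult_left_mono) (auto intro: mult_left_mono)
      also have "\<dots> < d * exp (L * (T - t0))"
        using z y(1) by (intro mult_strict_right_mono) (auto simp: dist_norm)
      also have "\<dots> = e" by (simp add: d_def flip: exp_add)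
      finally show ?thesis by (simp add: dist_norm)
    qed
    have small: "norm (y t) < R \<and> \<bar>t\<bar> < R" if "t \<in> {t0..T}" for t
    proof -
      have "norm (y t) \<le> norm (x t) + dist (x t) (y t)"
        using norm_triangle_sub[of "y t" "x t"] by (simp add: dist_norm norm_minus_commute)
      then show ?thesis using close[OF that] R0(2)[OF that] \<open>e > 0\<close> by (simp add: R_def)
    qed
    obtain J' where "solves_on F y J'" "{t0..T} \<subseteq> J'"
      using solves_on_of_truncation[OF agree y(2) small \<open>t0 \<le> T\<close>] by blast
    then show "\<exists>y J'. solves_on F y J' \<and> {t0..T} \<subseteq> J' \<and> y t0 = z \<and> (\<forall>t\<in>{t0..T}. dist (x t) (y t) < e)"
      using y(1) close by blast
  qed
qed

section \<open>Local and maximal solutions\<close>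

lemma local_solution:
  obtains y J where "solves_on F y J" "t0 \<in> J" "y t0 = z"
proof -
  define R where "R = norm z + \<bar>t0\<bar> + 1"
  have "R > 0" by (simp add: R_def add_nonneg_pos)
  then obtain G where agree: "\<And>z t. norm z \<le> R \<Longrightarrow> \<bar>t\<bar> \<le> R \<Longrightarrow> G z t = F z t"
    and ex: "\<And>t0 z. \<exists>y. y t0 = z \<and> (\<forall>t. (y has_vector_derivative G (y t) t) (at t))"
    using truncation[OF \<open>R > 0\<close>] by blast
  obtain y where y: "y t0 = z" "\<And>t. (y has_vector_derivative G (y t) t) (at t)" using ex by blast
  have small: "norm (y t) < R \<and> \<bar>t\<bar> < R" if "t \<in> {t0..t0}" for t
    using that y(1) norm_ge_zero[of z] by (simp add: R_def add_nonneg_pos)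
  obtain J where "solves_on F y J" "{t0..t0} \<subseteq> J"
    using solves_on_of_truncation[OF agree y(2) small] by blast
  then show ?thesis using that y(1) by simp
qed

text \<open>The union of all solutions through the initial point: by uniqueness they agree wherever
  two are defined, so the value picked at each time is independent of the choice. Any extension of
  the union belongs to the family and so adds nothing.\<close>

lemma maximal_solution_exists: "\<exists>x J. maximal_solution F t0 z x J"
proof -
  define \<S> where "\<S> = {(y, J). solves_on F y J \<and> t0 \<in> J \<and> y t0 = z}"
  define J where "J = \<Union>(snd ` \<S>)"
  define Q where "Q t v \<longleftrightarrow> (\<exists>y J. (y, J) \<in> \<S> \<and> t \<in> J \<and> v = y t)" for t v
  define x where "x t = (SOME v. Q t v)" for t
  have x: "x t = y t" if yJ: "(y, J') \<in> \<S>" "t \<in> J'" for y J' t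
  proof -
    have "Q t (y t)" using yJ by (auto simp: Q_def)
    then have "Q t (x t)" unfolding x_def by (rule someI)
    then obtain y' J'' where y': "(y', J'') \<in> \<S>" "t \<in> J''" "x t = y' t"
      unfolding Q_def by blast
    have "solves_on F y' J''" "solves_on F y J'" "t0 \<in> J'' \<inter> J'" "t \<in> J'' \<inter> J'" "y' t0 = y t0"
      using yJ y'(1,2) by (simp_all add: \<S>_def)
    then have "y' t = y t" by (rule solution_unique)
    then show ?thesis using y'(3) by simp
  qed
  obtain y0 J0 where 0: "(y0, J0) \<in> \<S>" using local_solution unfolding \<S>_def by blast
  then have "t0 \<in> J" "x t0 = z" using x[OF 0] unfolding \<S>_def J_def by force+
  have "open J" unfolding J_def by (intro open_Union) (auto simp: \<S>_def solves_on_def)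
  moreover have "is_interval J"
    unfolding J_def is_interval_connected_1
    by (rule connected_Union[where ?S = "snd ` \<S>"])
      (auto simp: \<S>_def solves_on_def is_interval_connected_1)
  moreover have "(x has_vector_derivative F (x t) t) (at t)" if tJ: "t \<in> J" for t
  proof -
    obtain y J' where yJ: "(y, J') \<in> \<S>" "t \<in> J'" using tJ by (auto simp: J_def)
    have "(y has_vector_derivative F (y t) t) (at t)" "open J'"
      using yJ by (auto simp: \<S>_def solves_on_def)
    then show ?thesis
      using has_vector_derivative_transform_within_open[of y _ t J' x] yJ x by metis
  qed
  ultimately have sol: "solves_on F x J" by (simp add: solves_on_def)
  have "J' = J" if "solves_on F y J'" "J \<subseteq> J'" "\<forall>t\<in>J. y t = x t" for y J'
  proof -
    have "(y, J') \<in> \<S>" using that \<open>t0 \<in> J\<close> \<open>x t0 = z\<close> by (auto simp: \<S>_def)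
    then show ?thesis using that(2) unfolding J_def by force
  qed
  then show ?thesis
    unfolding maximal_solution_def using sol \<open>t0 \<in> J\<close> \<open>x t0 = z\<close> by blast
qed

section \<open>Initial values sorted by their exit\<close>

text \<open>Requiring the solution to stay in \<open>S\<close> up to the time \<open>T\<close> records the first exit only:
  the field is defined on the whole plane, so a solution that has left a region may return to it.\<close>

definition reach :: "real \<Rightarrow> (real \<times> real) set \<Rightarrow> (real \<times> real) set \<Rightarrow> (real \<times> real) set" where
  "reach t0 S E = {z. \<exists>x J T. solves_on F x J \<and> t0 \<le> T \<and> {t0..T} \<subseteq> J \<and> x t0 = z \<and>
     x ` {t0..T} \<subseteq> S \<and> x T \<in> E}"

text \<open>By compactness a tube around the trajectory lies in \<open>S\<close>. Continuous
  dependence keeps neighbouring solutions in this tube up to the same time \<open>T\<close> and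
  brings them into \<open>E\<close> at \<open>T\<close>.\<close>

lemma open_reach:
  assumes "open S" "open E"
  shows "open (reach t0 S E)"
  unfolding open_dist
proof
  fix z assume "z \<in> reach t0 S E"
  then obtain x J T where x: "solves_on F x J" and T: "t0 \<le> T" "{t0..T} \<subseteq> J" and z: "x t0 = z"
    and S: "x ` {t0..T} \<subseteq> S" and E: "x T \<in> E"
    unfolding reach_def by blast
  have "compact (x ` {t0..T})"
    using solution_continuous[OF x T(2)] by (intro compact_continuous_image) auto
  then obtain e1 where e1: "e1 > 0" "(\<Union>v\<in>x ` {t0..T}. ball v e1) \<subseteq> S"
    using compact_subset_open_imp_ball_epsilon_subset S assms(1) by blast
  obtain e2 where e2: "e2 > 0" "ball (x T) e2 \<subseteq> E" using E assms(2) open_contains_ball by blast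
  have "min e1 e2 > 0" using e1 e2 by simp
  from continuous_dependence[OF x T(2,1) this] obtain d where d: "d > 0"
    "\<And>z. dist (x t0) z < d \<Longrightarrow> \<exists>y J'. solves_on F y J' \<and> {t0..T} \<subseteq> J' \<and> y t0 = z \<and>
        (\<forall>t\<in>{t0..T}. dist (x t) (y t) < min e1 e2)" by blast
  have "z' \<in> reach t0 S E" if z': "dist z' z < d" for z'
  proof -
    obtain y J' where y: "solves_on F y J'" "{t0..T} \<subseteq> J'" "y t0 = z'"
      "\<forall>t\<in>{t0..T}. dist (x t) (y t) < min e1 e2"
      using d(2)[of z'] z' by (auto simp: z dist_commute)
    have "y t \<in> S" if "t \<in> {t0..T}" for t
    proof -
      have "y t \<in> ball (x t) e1" using y(4) that by simp
      then show ?thesis using e1(2) that by blast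
    qed
    moreover have "y T \<in> ball (x T) e2" using y(4) T(1) by simp
    ultimately have "y ` {t0..T} \<subseteq> S" "y T \<in> E" using e2(2) by blast+
    then show ?thesis unfolding reach_def using y(1-3) T(1) by blast
  qed
  then show "\<exists>e>0. \<forall>y. dist y z < e \<longrightarrow> y \<in> reach t0 S E" using d(1) by blast
qed

text \<open>By uniqueness both memberships describe the same solution. At the earlier of the two
  arrival times it is in one target and still in the region prescribed for the other, which the
  hypotheses exclude.\<close>

lemma reach_disjoint:
  assumes "E \<inter> S' = {}" "S \<inter> E' = {}"
  shows "reach t0 S E \<inter> reach t0 S' E' = {}"
proof (rule ccontr)
  assume "\<not> ?thesis"
  then obtain z where z: "z \<in> reach t0 S E" "z \<in> reach t0 S' E'" by blast
  obtain x J T where x: "solves_on F x J" "t0 \<le> T" "{t0..T} \<subseteq> J" "x ` {t0..T} \<subseteq> S" "x T \<in> E"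
    and xz: "x t0 = z"
    using z(1) unfolding reach_def by blast
  obtain y J' T' where y: "solves_on F y J'" "t0 \<le> T'" "{t0..T'} \<subseteq> J'" "y ` {t0..T'} \<subseteq> S'" "y T' \<in> E'"
    and yz: "y t0 = z"
    using z(2) unfolding reach_def by blast
  have eq: "x t0 = y t0" by (simp add: xz yz)
  have xy: "x t = y t" if "t \<in> {t0..T}" "t \<in> {t0..T'}" for t
    by (rule solution_unique[OF x(1) y(1) _ _ eq]) (use that x y in auto)
  show False
  proof (cases "T \<le> T'")
    case True
    then have "x T \<in> S'" using xy[of T] x(2) y(4) by auto
    then show ?thesis using x(5) assms by blast
  next
    case False
    then have "y T' \<in> S" using xy[of T'] y(2) x(4) by (metis atLeastAtMost_iff imageI linear order_refl subsetD)
    then show ?thesis using y(5) assms by blast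
  qed
qed

end

section \<open>The pendulum\<close>

lemma abs_sin_diff_le: "\<bar>sin a - sin b\<bar> \<le> \<bar>a - b\<bar>" for a b :: real
proof -
  have "\<bar>sin a - sin b\<bar> = 2 * \<bar>sin ((a - b) / 2)\<bar> * \<bar>cos ((a + b) / 2)\<bar>"
    by (simp add: sin_diff_sin abs_mult)
  also have "\<dots> \<le> 2 * \<bar>(a - b) / 2\<bar> * 1"
    by (intro mult_mono abs_sin_x_le_abs_x) auto
  finally show ?thesis by simp
qed

lemma abs_cos_diff_le: "\<bar>cos a - cos b\<bar> \<le> \<bar>a - b\<bar>" for a b :: real
  using abs_sin_diff_le[of "pi / 2 - a" "pi / 2 - b"]
  by (simp add: sin_diff abs_minus_commute)

lemma Lip_continuous: "f \<in> Lip \<Longrightarrow> continuous_on UNIV f"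
  by (simp add: Lip_def)

lemma Lip_bounds:
  assumes "f \<in> Lip"
  obtains L A where "L \<ge> 0" "A \<ge> 0"
    and "\<And>q p q' p' t. (q, p) \<in> cball 0 R \<Longrightarrow> (q', p') \<in> cball 0 R \<Longrightarrow> t \<in> {-R..R} \<Longrightarrow>
      \<bar>f (q, p, t) - f (q', p', t)\<bar> \<le> L * norm ((q, p) - (q', p'))"
    and "\<And>q p t. (q, p) \<in> cball 0 R \<Longrightarrow> t \<in> {-R..R} \<Longrightarrow> \<bar>f (q, p, t)\<bar> \<le> A"
proof -
  \<comment> \<open>\<open>Lip\<close> speaks of compact sets of triples \<open>(q, p, t)\<close>,
    so the product of the ball and the time interval is reassociated.\<close>
  define K where "K = (\<lambda>(z :: real \<times> real, t :: real). (fst z, snd z, t)) ` (cball 0 R \<times> {-R..R})"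
  have K: "compact K"
    unfolding K_def case_prod_beta
    by (intro compact_continuous_image compact_Times continuous_intros) auto
  have in_K: "(q, p, t) \<in> K" if "(q, p) \<in> cball 0 R" "t \<in> {-R..R}" for q p t
    unfolding K_def using that by (intro image_eqI[of _ _ "((q, p), t)"]) auto
  obtain L where L: "\<And>t. L-lipschitz_on {(q, p). (q, p, t) \<in> K} (\<lambda>(q, p). f (q, p, t))"
    using assms K unfolding Lip_def by blast
  have "compact (f ` K)"
    using K continuous_on_subset[OF Lip_continuous[OF assms]] by (intro compact_continuous_image) auto
  then obtain A where A: "\<And>v. v \<in> f ` K \<Longrightarrow> norm v \<le> A"
    using compact_imp_bounded bounded_iff by metis
  show ?thesis
  proof (rule that[of L "\<bar>A\<bar>"])
    show "L \<ge> 0" using L lipschitz_on_nonneg by blast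
    fix q p q' p' t :: real assume *: "(q, p) \<in> cball 0 R" "t \<in> {-R..R}"
    show "\<bar>f (q, p, t)\<bar> \<le> \<bar>A\<bar>" using A[of "f (q, p, t)"] in_K[OF *] by force
    assume "(q', p') \<in> cball 0 R"
    then show "\<bar>f (q, p, t) - f (q', p', t)\<bar> \<le> L * norm ((q, p) - (q', p'))"
      using lipschitz_onD[OF L[of t], of "(q, p)" "(q', p')"] in_K * by (simp add: dist_norm)
  qed simp
qed

lemma pendulum_locally_lipschitz:
  assumes u: "u \<in> Lip" and w: "w \<in> Lip"
  shows "locally_lipschitz_field (pendulum_field u w)"
proof
  have *: "continuous_on UNIV (\<lambda>s. f (fst (fst s), snd (fst s), snd s))" if "f \<in> Lip"
    for f :: "real \<times> real \<times> real \<Rightarrow> real"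
    by (rule continuous_on_compose2[OF Lip_continuous[OF that]]) (auto intro!: continuous_intros)
  show "continuous_on UNIV (\<lambda>(z, t). pendulum_field u w z t)"
    unfolding pendulum_field_def case_prod_beta
    by (intro continuous_intros *[OF u] *[OF w])
  fix R
  obtain Lu Au where Lu: "Lu \<ge> 0" "Au \<ge> 0"
    "\<And>q p q' p' t. (q, p) \<in> cball 0 R \<Longrightarrow> (q', p') \<in> cball 0 R \<Longrightarrow> t \<in> {-R..R} \<Longrightarrow>
      \<bar>u (q, p, t) - u (q', p', t)\<bar> \<le> Lu * norm ((q, p) - (q', p'))"
    "\<And>q p t. (q, p) \<in> cball 0 R \<Longrightarrow> t \<in> {-R..R} \<Longrightarrow> \<bar>u (q, p, t)\<bar> \<le> Au"
    using Lip_bounds[OF u] by metis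
  obtain Lw Aw where Lw: "Lw \<ge> 0" "Aw \<ge> (0 :: real)"
    "\<And>q p q' p' t. (q, p) \<in> cball 0 R \<Longrightarrow> (q', p') \<in> cball 0 R \<Longrightarrow> t \<in> {-R..R} \<Longrightarrow>
      \<bar>w (q, p, t) - w (q', p', t)\<bar> \<le> Lw * norm ((q, p) - (q', p'))"
    using Lip_bounds[OF w] by metis
  \<comment> \<open>In the constant, 2 collects the first component \<open>p\<close> and the term
    \<open>cos q\<close>; \<open>Lu + Au\<close> comes from the product of \<open>u\<close> and
    \<open>sin q\<close>, whose difference is split into one part for each factor; \<open>Lw\<close>
    comes from \<open>w\<close>.\<close>
  have "norm (pendulum_field u w (q, p) t - pendulum_field u w (q', p') t)
      \<le> (2 + Lu + Au + Lw) * norm ((q, p) - (q', p'))"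
    if t: "t \<in> {-R..R}" and z: "(q, p) \<in> cball 0 R" and z': "(q', p') \<in> cball 0 R" for t q p q' p'
  proof -
    define D where "D = norm ((q, p) - (q', p'))"
    have D: "\<bar>q - q'\<bar> \<le> D" "\<bar>p - p'\<bar> \<le> D"
      using norm_fst_le[of "q - q'" "p - p'"] norm_snd_le[of "p - p'" "q - q'"] by (auto simp: D_def)
    let ?u = "u (q, p, t)" and ?u' = "u (q', p', t)" and ?w = "w (q, p, t)" and ?w' = "w (q', p', t)"
    have 1: "\<bar>(?u - ?u') * sin q\<bar> \<le> Lu * D"
      using mult_mono[OF Lu(3)[OF z z' t] abs_sin_le_one[of q]] Lu(1) by (simp add: D_def abs_mult)
    have 2: "\<bar>?u' * (sin q - sin q')\<bar> \<le> Au * D"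
      unfolding abs_mult using Lu(2) D(1) abs_sin_diff_le[of q q']
      by (intro mult_mono Lu(4)[OF z' t]) auto
    have 3: "\<bar>cos q - cos q'\<bar> \<le> D" using abs_cos_diff_le[of q q'] D(1) by linarith
    have 4: "\<bar>?w - ?w'\<bar> \<le> Lw * D" unfolding D_def by (rule Lw(3)[OF z z' t])
    have "(?u * sin q - cos q + ?w) - (?u' * sin q' - cos q' + ?w')
        = (?u - ?u') * sin q + ?u' * (sin q - sin q') - (cos q - cos q') + (?w - ?w')"
      by (simp add: algebra_simps)
    then have "\<bar>(?u * sin q - cos q + ?w) - (?u' * sin q' - cos q' + ?w')\<bar> \<le> Lu * D + Au * D + D + Lw * D"
      using 1 2 3 4 by linarith
    moreover have "norm (pendulum_field u w (q, p) t - pendulum_field u w (q', p') t)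
        \<le> \<bar>p - p'\<bar> + \<bar>(?u * sin q - cos q + ?w) - (?u' * sin q' - cos q' + ?w')\<bar>"
      using norm_Pair_le[of "p - p'" "(?u * sin q - cos q + ?w) - (?u' * sin q' - cos q' + ?w')"]
      by (simp add: pendulum_field_def)
    ultimately have "norm (pendulum_field u w (q, p) t - pendulum_field u w (q', p') t)
        \<le> D + (Lu * D + Au * D + D + Lw * D)" using D(2) by linarith
    also have "\<dots> = (2 + Lu + Au + Lw) * D" by (simp add: algebra_simps)
    finally show ?thesis unfolding D_def .
  qed
  then show "\<exists>L\<ge>0. \<forall>t\<in>{-R..R}. \<forall>z\<in>cball 0 R. \<forall>z'\<in>cball 0 R.
      norm (pendulum_field u w z t - pendulum_field u w z' t) \<le> L * norm (z - z')"
    using Lu(1,2) Lw(1) by (intro exI[of _ "2 + Lu + Au + Lw"]) (simp add: split_paired_all)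
qed

section \<open>First contact with a boundary line, and small sublevel sets\<close>

lemma exit_transversal:
  fixes h v :: "real \<Rightarrow> real"
  assumes h: "\<And>t. t \<in> {t0..T} \<Longrightarrow> (h has_real_derivative v t) (at t)"
    and v: "(v has_real_derivative a) (at T)"
    and "t0 \<le> T" "h T = 0" and pos: "\<And>t. t0 \<le> t \<Longrightarrow> t < T \<Longrightarrow> h t > 0"
    and start: "T = t0 \<Longrightarrow> v T < 0" and tangent: "v T = 0 \<Longrightarrow> a < 0"
  shows "v T < 0"
\<comment> \<open>If \<open>v T \<ge> 0\<close>, then \<open>v\<close> is positive just before
  \<open>T\<close>: by continuity if \<open>v T > 0\<close>, because \<open>a < 0\<close> if
  \<open>v T = 0\<close>. So \<open>h\<close> increases to \<open>h T = 0\<close> and is negative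
  shortly before, contrary to \<open>pos\<close>. The case \<open>T = t0\<close>, where no earlier
  time exists, is excluded by \<open>start\<close>.\<close>
proof (rule ccontr)
  assume "\<not> v T < 0"
  then have "v T \<ge> 0" by simp
  then have "t0 < T" using start \<open>t0 \<le> T\<close> by (cases "t0 = T") auto
  have "\<exists>d>0. \<forall>s>0. s < d \<longrightarrow> v (T - s) > 0"
  proof (cases "v T = 0")
    case True
    then show ?thesis using has_real_derivative_neg_dec_left[OF v tangent] by auto
  next
    case False
    have "(v \<longlongrightarrow> v T) (at T)" using DERIV_isCont[OF v] by (simp add: isCont_def)
    then have "\<forall>\<^sub>F t in at T. v t > 0" using False \<open>v T \<ge> 0\<close> by (intro order_tendstoD) auto
    then obtain d where "d > 0" "\<And>t. t \<noteq> T \<Longrightarrow> dist t T < d \<Longrightarrow> v t > 0"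
      unfolding eventually_at by auto
    then show ?thesis by (intro exI[of _ d]) (auto simp: dist_real_def)
  qed
  then obtain d where d: "d > 0" "\<And>s. s > 0 \<Longrightarrow> s < d \<Longrightarrow> v (T - s) > 0" by blast
  define s where "s = min (d / 2) (T - t0)"
  have s: "s > 0" "s < d" "t0 \<le> T - s" using d(1) \<open>t0 < T\<close> by (auto simp: s_def)
  have "h (T - s) < h T"
  proof (rule DERIV_pos_imp_increasing_open[of "T - s" T h])
    show "T - s < T" using s by simp
    show "\<exists>y. DERIV h t :> y \<and> y > 0" if "T - s < t" "t < T" for t
      using h[of t] d(2)[of "T - t"] that s by auto
    show "continuous_on {T - s..T} h"
      using s by (intro continuous_at_imp_continuous_on ballI DERIV_isCont[OF h]) auto
  qed
  then show False using pos[of "T - s"] s \<open>h T = 0\<close> by simp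
qed

text \<open>\<open>c\<close> lies below the minimum of \<open>V\<close> on a small sphere around
  \<open>\<mu>\<close>, so the part of the sublevel set inside the ball does not reach the sphere.
  It is therefore closed in the whole space although the ball is open.\<close>

lemma isolated_sublevel:
  fixes V :: "'a::euclidean_space \<Rightarrow> real"
  assumes "\<mu> \<in> interior U" and V: "continuous_on U V"
    and "V \<mu> = 0" and pos: "\<And>z. z \<in> U - {\<mu>} \<Longrightarrow> V z > 0"
  obtains N c where "open N" "N \<subseteq> interior U" "c > 0" "\<mu> \<in> {z \<in> N. V z < c}"
    "open {z \<in> N. V z < c}" "closed {z \<in> N. V z \<le> c}"
proof -
  obtain r where r: "r > 0" "cball \<mu> r \<subseteq> interior U"
    using assms(1) open_contains_cball[of "interior U"] by auto
  have cV: "continuous_on (cball \<mu> r) V"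
    using r(2) interior_subset continuous_on_subset[OF V] by blast
  \<comment> \<open>A unit vector, which shows that the sphere is nonempty and the minimum
    attained.\<close>
  obtain b :: 'a where b: "b \<in> Basis" using nonempty_Basis by blast
  have "\<mu> + r *\<^sub>R b \<in> sphere \<mu> r" using r(1) b by (simp add: dist_norm)
  then have "sphere \<mu> r \<noteq> {}" by blast
  from continuous_attains_inf[OF compact_sphere this continuous_on_subset[OF cV sphere_cball]]
  obtain z0 where z0: "z0 \<in> sphere \<mu> r" "\<And>z. z \<in> sphere \<mu> r \<Longrightarrow> V z0 \<le> V z" by blast
  define c where "c = V z0 / 2"
  have "z0 \<in> U - {\<mu>}" using z0(1) r interior_subset by fastforce
  then have c: "c > 0" using pos by (simp add: c_def)
  show ?thesis
  proof (rule that[of "ball \<mu> r" c])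
    show "ball \<mu> r \<subseteq> interior U" using r(2) ball_subset_cball by blast
    have "{z \<in> ball \<mu> r. V z < c} = ball \<mu> r \<inter> V -` {..<c}" by auto
    moreover have "open (ball \<mu> r \<inter> V -` {..<c})"
      using ball_subset_cball by (intro continuous_open_preimage continuous_on_subset[OF cV]) auto
    ultimately show "open {z \<in> ball \<mu> r. V z < c}" by simp
    have "V z > c" if "z \<in> sphere \<mu> r" for z using z0(2)[OF that] c by (simp add: c_def)
    then have "{z \<in> ball \<mu> r. V z \<le> c} = cball \<mu> r \<inter> V -` {..c}"
      by (force simp: less_le)
    moreover have "closed (cball \<mu> r \<inter> V -` {..c})"
      by (intro continuous_closed_preimage cV) auto
    ultimately show "closed {z \<in> ball \<mu> r. V z \<le> c}" by simp
  qed (use c r(1) \<open>V \<mu> = 0\<close> in auto)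
qed

lemma (in locally_lipschitz_field) reachI:
  assumes "solves_on F x J" "t0 \<le> T" "{t0..T} \<subseteq> J" "x ` {t0..T} \<subseteq> S" "x T \<in> E"
  shows "x t0 \<in> reach t0 S E"
  using assms unfolding reach_def by blast

text \<open>At first contact the solution may be only on the boundary of the open target and enter
  it right afterwards. As \<open>S\<close> is open, the solution also remains in \<open>S\<close>
  for a while, so a slightly later time serves as arrival time.\<close>

lemma (in locally_lipschitz_field) reach_right_limit:
  assumes x: "solves_on F x J" and T: "t0 \<le> T" "{t0..T} \<subseteq> J" "x ` {t0..T} \<subseteq> S"
    and "open S" and E: "\<forall>\<^sub>F t in at_right T. x t \<in> E"
  shows "x t0 \<in> reach t0 S E"
proof -
  have "open J" using x by (simp add: solves_on_def)
  have "open (J \<inter> x -` S)"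
    using solution_continuous[OF x order_refl] \<open>open J\<close> \<open>open S\<close> by (rule continuous_open_preimage)
  moreover have "T \<in> J \<inter> x -` S" using T by auto
  ultimately obtain e where e: "e > 0" "ball T e \<subseteq> J \<inter> x -` S" using open_contains_ball by blast
  obtain b where b: "b > T" "\<And>t. T < t \<Longrightarrow> t < b \<Longrightarrow> x t \<in> E"
    using E by (auto simp: eventually_at_right_field)
  define T' where "T' = T + min e (b - T) / 2"
  have T': "T < T'" "T' < b" "T' < T + e" 
    using e(1) b(1) by (auto simp: T'_def min_def field_simps)
  have in_JS: "t \<in> J \<and> x t \<in> S" if "t \<in> {t0..T'}" for t
  proof (cases "t \<le> T")
    case True then show ?thesis using T that by auto
  next
    case False
    then have "t \<in> ball T e" using that T' by (simp add: dist_real_def)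
    then show ?thesis using e(2) by blast
  qed
  show ?thesis
    by (rule reachI[OF x, of t0 T']) (use T(1) T' in_JS b(2) in auto)
qed

lemma has_real_derivative_neg_eventually_less:
  fixes f :: "real \<Rightarrow> real"
  assumes "(f has_real_derivative l) (at x)" "l < 0"
  shows "\<forall>\<^sub>F y in at_right x. f y < f x"
proof -
  obtain d where d: "d > 0" "\<And>h. h > 0 \<Longrightarrow> h < d \<Longrightarrow> f (x + h) < f x"
    using has_real_derivative_neg_dec_right[OF assms] by auto
  have "f y < f x" if "x < y" "y < x + d" for y using d(2)[of "y - x"] that by simp
  then show ?thesis unfolding eventually_at_right_field using d(1) by (intro exI[of _ "x + d"]) auto
qed

section \<open>The three exit sets and the connectedness argument\<close>

theorem mainTheorem4:
  fixes u w :: "real \<times> real \<times> real \<Rightarrow> real"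
    and t0 :: real
    and \<mu> :: "real \<times> real"
    and U :: "(real \<times> real) set"
    and V Vq Vp :: "real \<times> real \<Rightarrow> real"
  assumes "u \<in> Lip" and "w \<in> Lip"
    and "\<And>t. w (0, 0, t) < 1"
    and "\<And>t. w (pi, 0, t) > -1"
    and "\<mu> \<in> M"
    and "equilibrium (pendulum_field u w) \<mu>"
    and "closedin (top_of_set M) U"
    and "\<mu> \<in> U - frontier U"
    and "C1_on U V Vq Vp"
    and L1: "V \<mu> = 0" "\<And>z. z \<in> U - {\<mu>} \<Longrightarrow> V z > 0"
    and L2: "\<And>z t. z \<in> U - {\<mu>} \<Longrightarrow> derivative_along Vq Vp (pendulum_field u w) z t < 0"
  shows "\<exists>z0 B. open B \<and> B \<subseteq> M \<and> \<mu> \<in> B \<and>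
    (\<exists>x J. maximal_solution (pendulum_field u w) t0 z0 x J) \<and>
    (\<forall>x J. maximal_solution (pendulum_field u w) t0 z0 x J \<longrightarrow>
       (\<forall>t\<in>J. t \<ge> t0 \<longrightarrow> x t \<in> M - B))"
proof -
  define F where "F = pendulum_field u w"
  interpret locally_lipschitz_field F
    unfolding F_def using assms(1,2) by (rule pendulum_locally_lipschitz)
  have F: "F z t = (snd z, snd (F z t))" for z t
    by (simp add: F_def pendulum_field_def case_prod_beta)
  have "U \<subseteq> M" using assms(7) closedin_imp_subset by blast
  have "\<mu> \<in> interior U" using assms(8) by (auto simp: frontier_def closure_def)
  have derV: "(V has_derivative (\<lambda>(hq, hp). Vq z * hq + Vp z * hp)) (at z within U)" if "z \<in> U" for z
    using assms(9) that by (simp add: C1_on_def)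
  have cV: "continuous_on U V" by (rule has_derivative_continuous_on[OF derV])
  obtain N c where "open N" "N \<subseteq> interior U" "c > 0" and \<mu>_in: "\<mu> \<in> {z \<in> N. V z < c}"
    and B_open: "open {z \<in> N. V z < c}" and K_closed: "closed {z \<in> N. V z \<le> c}"
    by (rule isolated_sublevel[where V = V, OF \<open>\<mu> \<in> interior U\<close> cV L1])
  \<comment> \<open>\<open>B\<close> is the neighbourhood to be avoided. Its closed companion
    \<open>K\<close> provides a first time of contact and is removed from the regions leading to the
    other two exits.\<close>
  define B where "B = {z \<in> N. V z < c}"
  define K where "K = {z \<in> N. V z \<le> c}"
  have "B \<subseteq> K" by (auto simp: B_def K_def)
  have "K \<subseteq> U" using \<open>N \<subseteq> interior U\<close> interior_subset by (auto simp: K_def)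
  have "K \<subseteq> M" using \<open>K \<subseteq> U\<close> \<open>U \<subseteq> M\<close> by blast
  have M_eq: "M = {z. 0 < fst z} \<inter> {z. fst z < pi}" by (auto simp: M_def)
  have open_right: "open {z :: real \<times> real. a < fst z}" and open_left: "open {z :: real \<times> real. fst z < a}" for a
    by (intro open_Collect_less continuous_intros)+
  have "open M" unfolding M_eq by (intro open_Int open_right open_left)
  \<comment> \<open>\<open>SL\<close> contains the line \<open>q = 0\<close> but no point with
    \<open>q \<ge> pi\<close> and none of \<open>K\<close>, so a path in it that ends at
    \<open>q < 0\<close> has used no other exit before. \<open>SR\<close> mirrors it.\<close>
  define SL SR where "SL = {z. fst z < pi} - K" and "SR = {z. 0 < fst z} - K"
  define RL where "RL = reach t0 SL {z. fst z < 0}"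
  define RR where "RR = reach t0 SR {z. pi < fst z}"
  define RB where "RB = reach t0 M B"
  have "open SL" "open SR"
    unfolding SL_def SR_def K_def by (intro open_Diff open_right open_left K_closed)+
  then have opens: "open RL" "open RR" "open RB"
    unfolding RL_def RR_def RB_def B_def
    by (auto intro!: open_reach open_right open_left B_open \<open>open M\<close>)
  \<comment> \<open>For the connectedness argument the exits are grouped into two open sets,
    \<open>RL\<close> and \<open>RR \<union> RB\<close>.\<close>
  have disjoint: "RL \<inter> (RR \<union> RB) = {}"
  proof -
    have "RL \<inter> RR = {}" unfolding RL_def RR_def
      by (rule reach_disjoint) (auto simp: SL_def SR_def)
    moreover have "RL \<inter> RB = {}" unfolding RL_def RB_def
      by (rule reach_disjoint) (use \<open>B \<subseteq> K\<close> in \<open>auto simp: SL_def M_eq\<close>)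
    ultimately show ?thesis by blast
  qed
  \<comment> \<open>The velocity \<open>p\<close> points outwards at both ends: it is
    \<open>- pi / 2\<close> at \<open>q = 0\<close> and \<open>pi / 2\<close> at
    \<open>q = pi\<close>.\<close>
  define Z where "Z = (\<lambda>q. (q, q - pi / 2)) ` {0..pi}"
  have "connected Z"
    unfolding Z_def by (intro connected_continuous_image continuous_intros) auto

  \<comment> \<open>Derivatives along solutions\<close>
  have der_fst: "((\<lambda>t. fst (x t)) has_real_derivative snd (x t)) (at t)"
    and der_snd: "((\<lambda>t. snd (x t)) has_real_derivative snd (F (x t) t)) (at t)"
    if "solves_on F x J" "t \<in> J" for x J t
  proof -
    have x: "(x has_vector_derivative F (x t) t) (at t)" using that by (simp add: solves_on_def)
    have "fst (F (x t) t) = snd (x t)" by (subst F) simp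
    then show "((\<lambda>t. fst (x t)) has_real_derivative snd (x t)) (at t)"
      using bounded_linear.has_vector_derivative[OF bounded_linear_fst x]
      by (simp add: has_real_derivative_iff_has_vector_derivative)
    show "((\<lambda>t. snd (x t)) has_real_derivative snd (F (x t) t)) (at t)"
      using bounded_linear.has_vector_derivative[OF bounded_linear_snd x]
      by (simp add: has_real_derivative_iff_has_vector_derivative)
  qed
  have der_V: "((\<lambda>t. V (x t)) has_real_derivative derivative_along Vq Vp F (x t) t) (at t)"
    if "solves_on F x J" "t \<in> J" "x t \<in> interior U" for x J t
  proof -
    have x: "(x has_vector_derivative F (x t) t) (at t)" using that by (simp add: solves_on_def)
    \<comment> \<open>\<open>V\<close> is differentiable relative to \<open>U\<close>; at interior
      points this is the full derivative, and the chain rule applies.\<close>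
    have "(V has_derivative (\<lambda>(hq, hp). Vq (x t) * hq + Vp (x t) * hp)) (at (x t))"
      using derV[of "x t"] that(3) interior_subset at_within_interior by (metis subsetD)
    then have "(V has_derivative (\<lambda>(hq, hp). Vq (x t) * hq + Vp (x t) * hp)) (at (x t) within range x)"
      by (rule has_derivative_at_withinI)
    from vector_derivative_diff_chain_within[OF x this] show ?thesis
      by (simp add: has_real_derivative_iff_has_vector_derivative o_def derivative_along_def case_prod_beta)
  qed

  \<comment> \<open>Crossing at first contact\<close>
  have leave_left: "x t0 \<in> RL"
    if sol: "solves_on F x J" and T: "t0 \<le> T" "{t0..T} \<subseteq> J" "x ` {t0..T} \<subseteq> SL"
      and "fst (x T) = 0" "snd (x T) < 0" for x J T
  proof -
    have "T \<in> J" using T by auto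
    have "\<forall>\<^sub>F t in at_right T. x t \<in> {z. fst z < 0}"
      using has_real_derivative_neg_eventually_less[OF der_fst[OF sol \<open>T \<in> J\<close>] that(6)] that(5) by simp
    then show ?thesis unfolding RL_def by (rule reach_right_limit[OF sol T \<open>open SL\<close>])
  qed
  have leave_right: "x t0 \<in> RR"
    if sol: "solves_on F x J" and T: "t0 \<le> T" "{t0..T} \<subseteq> J" "x ` {t0..T} \<subseteq> SR"
      and "fst (x T) = pi" "- snd (x T) < 0" for x J T
  proof -
    have "T \<in> J" using T by auto
    have "\<forall>\<^sub>F t in at_right T. x t \<in> {z. pi < fst z}"
      using has_real_derivative_neg_eventually_less[OF DERIV_minus[OF der_fst[OF sol \<open>T \<in> J\<close>]] that(6)] that(5)
      by simp
    then show ?thesis unfolding RR_def by (rule reach_right_limit[OF sol T \<open>open SR\<close>])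
  qed

  have exits: "z \<in> RL \<union> RR \<union> RB"
    if "z \<in> Z" and sol: "solves_on F x J" and "t0 \<in> J" "x t0 = z" "t1 \<in> J" "t0 \<le> t1" "x t1 \<notin> M - B"
    for z x J t1
  proof -
    have "is_interval J" using sol by (simp add: solves_on_def)
    then have "{t0..t1} \<subseteq> J"
      using \<open>t0 \<in> J\<close> \<open>t1 \<in> J\<close> unfolding is_interval_1 by (meson atLeastAtMost_iff subsetI)
    \<comment> \<open>With \<open>K\<close> in place of \<open>B\<close> this set of times is
      closed, so it has a first element \<open>T\<close>; before \<open>T\<close> the solution lies
      in \<open>M - K\<close>.\<close>
    define C where "C = {t0..t1} \<inter> x -` (- M \<union> K)"
    have "compact C"
      unfolding C_def compact_eq_bounded_closed using K_closed \<open>open M\<close> solution_continuous[OF sol \<open>{t0..t1} \<subseteq> J\<close>]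
      by (intro conjI bounded_Int continuous_closed_preimage closed_Un) (auto simp: K_def)
    moreover have "t1 \<in> C" using \<open>x t1 \<notin> M - B\<close> \<open>B \<subseteq> K\<close> \<open>t0 \<le> t1\<close> by (auto simp: C_def)
    ultimately obtain T where T: "T \<in> C" "\<And>t. t \<in> C \<Longrightarrow> T \<le> t"
      using compact_attains_inf[of C] by blast
    have "t0 \<le> T" and TJ: "{t0..T} \<subseteq> J" and "T \<in> J" and xT: "x T \<in> - M \<union> K"
      using T(1) \<open>{t0..t1} \<subseteq> J\<close> by (auto simp: C_def)
    have before: "x t \<in> M - K" if "t0 \<le> t" "t < T" for t
      using T(1) T(2)[of t] that by (force simp: C_def)
    have image: "x ` {t0..T} \<subseteq> S" if "M - K \<subseteq> S" "x T \<in> S" for S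
      using before that by (force simp: less_le)
    have start: "fst (x T) \<in> {0..pi}" "snd (x T) = fst (x T) - pi / 2" if "T = t0"
      using \<open>z \<in> Z\<close> \<open>x t0 = z\<close> that by (auto simp: Z_def)
    \<comment> \<open>As a limit of points of \<open>M\<close>, the point \<open>x T\<close> has
      \<open>0 \<le> q \<le> pi\<close>; if it is outside \<open>M\<close>, it lies on one of the
      two lines. For \<open>T = t0\<close> the bounds come from the segment.\<close>
    have range: "fst (x T) \<in> {0..pi}"
    proof (cases "T = t0")
      case False
      then have "T \<in> closure {t0..<T}" using \<open>t0 \<le> T\<close> by simp
      moreover have "closed ({t0..T} \<inter> x -` {z. fst z \<in> {0..pi}})"
        using solution_continuous[OF sol TJ]
        by (intro continuous_closed_preimage) (auto intro!: closed_Collect_conj closed_Collect_le continuous_intros)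
      moreover have "{t0..<T} \<subseteq> {t0..T} \<inter> x -` {z. fst z \<in> {0..pi}}"
        using before by (force simp: M_eq)
      ultimately show ?thesis using closure_minimal by blast
    qed (use start in simp)
    have derT: "((\<lambda>t. snd (x t)) has_real_derivative snd (F (x T) T)) (at T)"
      by (rule der_snd[OF sol \<open>T \<in> J\<close>])
    consider "fst (x T) = 0" | "fst (x T) = pi" | "x T \<in> K"
      using xT range by (force simp: M_eq)
    then show ?thesis
    proof cases
      case 1
      have "snd (x T) < 0"
      proof (rule exit_transversal[of t0 T "\<lambda>t. fst (x t)"])
        show "((\<lambda>t. fst (x t)) has_real_derivative snd (x t)) (at t)" if "t \<in> {t0..T}" for t
          using der_fst[OF sol] TJ that by blast
        show "0 < fst (x t)" if "t0 \<le> t" "t < T" for t using before[OF that] by (simp add: M_eq)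
        show "snd (x T) < 0" if "T = t0" using start[OF that] 1 by simp
        \<comment> \<open>At \<open>(0, 0)\<close> the acceleration is
          \<open>w (0, 0, T) - 1\<close>, negative by hypothesis.\<close>
        show "snd (F (x T) T) < 0" if "snd (x T) = 0"
          using 1 that assms(3)[of T] by (cases "x T") (simp add: F_def pendulum_field_def)
      qed (use derT \<open>t0 \<le> T\<close> 1 in auto)
      then have "x t0 \<in> RL"
        using 1 \<open>K \<subseteq> M\<close> by (intro leave_left[OF sol \<open>t0 \<le> T\<close> TJ image]) (auto simp: SL_def M_eq)
      then show ?thesis using \<open>x t0 = z\<close> by blast
    next
      case 2
      have "- snd (x T) < 0"
      proof (rule exit_transversal[of t0 T "\<lambda>t. pi - fst (x t)"])
        show "((\<lambda>t. pi - fst (x t)) has_real_derivative - snd (x t)) (at t)" if "t \<in> {t0..T}" for t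
          using DERIV_diff[OF DERIV_const[of pi] der_fst[OF sol, of t]] TJ that by auto
        show "((\<lambda>t. - snd (x t)) has_real_derivative - snd (F (x T) T)) (at T)"
          by (rule DERIV_minus[OF derT])
        show "0 < pi - fst (x t)" if "t0 \<le> t" "t < T" for t using before[OF that] by (simp add: M_eq)
        show "- snd (x T) < 0" if "T = t0" using start[OF that] 2 pi_gt_zero by linarith
        \<comment> \<open>At \<open>(pi, 0)\<close> the acceleration is
          \<open>1 + w (pi, 0, T)\<close>, positive by hypothesis.\<close>
        show "- snd (F (x T) T) < 0" if "- snd (x T) = 0"
          using 2 that assms(4)[of T] by (cases "x T") (simp add: F_def pendulum_field_def)
      qed (use \<open>t0 \<le> T\<close> 2 in auto)
      then have "x t0 \<in> RR"
        using 2 \<open>K \<subseteq> M\<close> by (intro leave_right[OF sol \<open>t0 \<le> T\<close> TJ image]) (auto simp: SR_def M_eq)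
      then show ?thesis using \<open>x t0 = z\<close> by blast
    next
      case 3
      have "x ` {t0..T} \<subseteq> M" using 3 \<open>K \<subseteq> M\<close> by (intro image) auto
      have "x t0 \<in> RB"
      proof (cases "V (x T) < c")
        case True
        then have "x T \<in> B" using 3 by (simp add: B_def K_def)
        then show ?thesis unfolding RB_def
          by (intro reachI[OF sol \<open>t0 \<le> T\<close> TJ \<open>x ` {t0..T} \<subseteq> M\<close>])
      next
        case False
        \<comment> \<open>On the level set \<open>V\<close> strictly decreases along the solution,
          and \<open>N\<close> is open, so the solution is in \<open>B\<close> immediately after
          \<open>T\<close>.\<close>
        then have "V (x T) = c" using 3 by (simp add: K_def)
        then have "x T \<in> U - {\<mu>}" using 3 \<open>K \<subseteq> U\<close> \<open>c > 0\<close> L1(1) by auto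
        then have "derivative_along Vq Vp F (x T) T < 0" unfolding F_def by (rule L2)
        moreover have "x T \<in> interior U" using 3 \<open>N \<subseteq> interior U\<close> by (auto simp: K_def)
        ultimately have "\<forall>\<^sub>F t in at_right T. V (x t) < V (x T)"
          by (intro has_real_derivative_neg_eventually_less[OF der_V[OF sol \<open>T \<in> J\<close>]])
        moreover have "\<forall>\<^sub>F t in at_right T. x t \<in> N"
        proof -
          have "isCont x T"
            using sol \<open>T \<in> J\<close> by (auto simp: solves_on_def intro: has_vector_derivative_continuous)
          then have "(x \<longlongrightarrow> x T) (at_right T)" by (simp add: isCont_def filterlim_at_split)
          then show ?thesis
            by (rule topological_tendstoD) (use \<open>open N\<close> 3 in \<open>auto simp: K_def\<close>)
        qed
        ultimately have "\<forall>\<^sub>F t in at_right T. x t \<in> B"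
          by eventually_elim (simp add: B_def \<open>V (x T) = c\<close>)
        then show ?thesis unfolding RB_def
          by (intro reach_right_limit[OF sol \<open>t0 \<le> T\<close> TJ \<open>x ` {t0..T} \<subseteq> M\<close> \<open>open M\<close>])
      qed
      then show ?thesis using \<open>x t0 = z\<close> by blast
    qed
  qed

  \<comment> \<open>Connectedness of the segment\<close>
  obtain z where "z \<in> Z" "z \<notin> RL \<union> RR \<union> RB"
  proof -
    obtain x J where x: "solves_on F x J" "t0 \<in> J" "x t0 = (0, - pi / 2)" by (rule local_solution)
    \<comment> \<open>The end point already lies on the line with outward velocity, so the crossing
      time is \<open>t0\<close> itself.\<close>
    have "x t0 \<in> RL"
      by (rule leave_left[OF x(1) order_refl]) (use x \<open>K \<subseteq> M\<close> in \<open>auto simp: SL_def M_eq\<close>)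
    moreover have "x t0 \<in> Z" unfolding Z_def x(3) by (rule image_eqI[of _ _ 0]) auto
    ultimately have left: "RL \<inter> Z \<noteq> {}" by blast
    obtain y J' where y: "solves_on F y J'" "t0 \<in> J'" "y t0 = (pi, pi / 2)" by (rule local_solution)
    have "y t0 \<in> RR"
      by (rule leave_right[OF y(1) order_refl]) (use y \<open>K \<subseteq> M\<close> in \<open>auto simp: SR_def M_eq\<close>)
    moreover have "y t0 \<in> Z" unfolding Z_def y(3) by (rule image_eqI[of _ _ pi]) auto
    ultimately have right: "RR \<inter> Z \<noteq> {}" by blast
    \<comment> \<open>Two open sets that are disjoint and both meet the connected \<open>Z\<close>
      cannot cover it.\<close>
    have "\<not> Z \<subseteq> RL \<union> (RR \<union> RB)"
      using connectedD[OF \<open>connected Z\<close> opens(1) open_Un[OF opens(2,3)]] disjoint left right by blast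
    then show ?thesis using that by blast
  qed
  have "x t \<in> M - B" if max: "maximal_solution F t0 z x J" and t: "t \<in> J" "t0 \<le> t" for x J t
  proof (rule ccontr)
    assume "x t \<notin> M - B"
    \<comment> \<open>A maximal solution is in particular a solution on an interval containing
      \<open>t0\<close> and \<open>t\<close>, so being outside \<open>M - B\<close> at time
      \<open>t\<close> would put \<open>z\<close> into one of the exit sets.\<close>
    then have "z \<in> RL \<union> RR \<union> RB"
      using max t by (intro exits[OF \<open>z \<in> Z\<close>]) (auto simp: maximal_solution_def)
    then show False using \<open>z \<notin> RL \<union> RR \<union> RB\<close> by blast
  qed
  moreover have "\<mu> \<in> B" "open B" "B \<subseteq> M"
    using \<mu>_in B_open \<open>B \<subseteq> K\<close> \<open>K \<subseteq> M\<close> by (auto simp: B_def)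
  ultimately show ?thesis
    using maximal_solution_exists[of t0 z] unfolding F_def by blast
qed

end
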